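(* Consider the $s$-stage space-time fully-discrete SI-IMEX-RK-DAE scheme for the Euler-Poisson system given in the context, based on a stiffly accurate DIRK scheme. Suppose that the data at time $t^n$ are well-prepared, i.e. $\rho^n_i=\rho^n_{(0),i}+\varepsilon^2\rho^n_{(2),i}$, $q^n_i=q^n_{(0),i}+\varepsilon^2q^n_{(2),i}$ with $\rho^n_{(0),i}=1$ and $\hat\nabla\cdot q^n_{(0),i}=0$ for all $i$. Then the intermediate solutions $(\rho_I^k,q_I^k,\phi_I^k)$, $k=1,\dots,s$, satisfy $$\lim_{\varepsilon\to0}\rho^k_{I,i}=\rho^k_{I,(0),i}=1,\qquad \lim_{\varepsilon\to0}\hat\nabla\cdot q^k_{I,i}=\hat\nabla\cdot q^k_{I,(0),i}=0$$ for all $i$. Moreover, the numerical solution $(\rho^{n+1}_i,q^{n+1}_i,\phi^{n+1}_i)$ after one time step is consistent with the reformulated incompressible Euler system; that is, the scheme transforms, as $\varepsilon\to0$, to an $s$-stage scheme for the incompressible limit system (in the sense given in the context). In other words, the fully-discrete scheme is asymptotically consistent.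
   Context: The one-fluid Euler-Poisson system is $\partial_t\rho+\nabla\cdot q=0$, $\partial_tq+\nabla\cdot(q\otimes q/\rho)+\nabla p(\rho)=\rho\nabla\phi$, $\varepsilon^2\Delta\phi=\rho-1$, with $p(\rho)=\rho^\gamma$, $\gamma>1$, $\varepsilon>0$, in three space dimensions. The reformulated incompressible Euler limit system is $\Delta\phi_{(0)}=\nabla^2:(u_{(0)}\otimes u_{(0)})$, $\partial_tu_{(0)}+\nabla\cdot(u_{(0)}\otimes u_{(0)})=\nabla\phi_{(0)}$, $\rho_{(0)}=1$, $\nabla\cdot u_{(0)}(0)=0$, where $\nabla^2:(v\otimes v)=\sum_{i,j}\partial_{x_i}\partial_{x_j}(v_iv_j)$. Runge-Kutta coefficients: $\tilde A=(\tilde a_{k,\ell})$ and $A=(a_{k,\ell})$ are $s\times s$ real matrices with $\tilde a_{k,\ell}=0$ for $\ell\ge k$, $a_{k,\ell}=0$ for $\ell>k$ (DIRK); stiffly accurate (SA) means the last row of $A$ equals the weight vector $\omega$. Grid notation: $i=(i_1,i_2,i_3)$ is a cell index, $e_m$ the $m$-th unit vector, $\Delta x_m>0$ the mesh sizes, $\Delta t>0$ the time step (mesh and time step are independent of $\varepsilon$), $\nu_m=\Delta t/\Delta x_m$. For quantities at half-integer indices, $\delta_{x_m}w_i=w_{i+\frac12e_m}-w_{i-\frac12e_m}$. When $\delta_{x_m}$ is applied to a cell grid function $w$, the half-index values are the averages $w_{i+\frac12e_m}=\frac12(w_{i+e_m}+w_i)$, so that $\delta_{x_m}w_i=\frac12(w_{i+e_m}-w_{i-e_m})$.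 The discrete gradient $\hat\nabla$ is obtained by replacing each derivative by the central difference, i.e. $(\hat\nabla w)_{m,i}=\delta_{x_m}w_i/\Delta x_m$, $\hat\nabla\cdot q_i=\sum_m\delta_{x_m}q_{m,i}/\Delta x_m$. Fluxes: with $U=(\rho,q)$, $F_{\rho,m}(U)=q_m$, $F_{q,m}(U)=\frac{q_m}{\rho}q+p(\rho)e_m$, $S_{q,m}(\phi)=\phi e_m$. For a stage $k$, $$\mathcal F^k_{\rho,m,i+\frac12e_m}=\tfrac12\big(F_{\rho,m}(U^k_{I,i+e_m})+F_{\rho,m}(U^k_{I,i})\big),$$ $$\mathcal F^k_{q,m,i+\frac12e_m}=\tfrac12\big(F_{q,m}(U^{k,+}_{E,i+\frac12e_m})+F_{q,m}(U^{k,-}_{E,i+\frac12e_m})\big)-\tfrac12\alpha_{m,i+\frac12e_m}\big(q^{k,+}_{E,i+\frac12e_m}-q^{k,-}_{E,i+\frac12e_m}\big),$$ $$\mathcal S^k_{q,m,i+\frac12e_m}=\tfrac12\big(S_{q,m}(\phi^k_{I,i+e_m})+S_{q,m}(\phi^k_{I,i})\big),\qquad \mathcal G^k_{I,m,i+\frac12e_m}=\frac1{\nu_m}\big(\rho^k_{E,i+e_m}-\rho^k_{E,i}\big),$$ where $w^\pm_{i+\frac12e_m}$ are the right (+) and left (−) interface values of a piecewise linear reconstruction (which reproduces constants) of the grid function $w$, and $\alpha_{m,i+\frac12e_m}=2\max\big(|q^{k,-}_{m,E}/\rho^{k,-}_E|,|q^{k,+}_{m,E}/\rho^{k,+}_E|\big)$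 evaluated at $i+\frac12e_m$. Scheme: for $k=1,\dots,s$, $$\rho^k_{E,i}=\rho^n_i-\sum_{\ell=1}^{k-1}\tilde a_{k,\ell}\sum_{m=1}^3\nu_m\delta_{x_m}\mathcal F^\ell_{\rho,m,i},$$ $$q^k_{E,i}=q^n_i-\sum_{\ell=1}^{k-1}\tilde a_{k,\ell}\sum_m\nu_m\delta_{x_m}\mathcal F^\ell_{q,m,i}+\sum_{\ell=1}^{k-1}\tilde a_{k,\ell}\sum_m\nu_m\rho^\ell_{E,i}\delta_{x_m}\mathcal S^\ell_{q,m,i},$$ $$\hat\rho^k_{I,i}=\rho^n_i-\sum_{\ell=1}^{k-1}a_{k,\ell}\sum_m\nu_m\delta_{x_m}\mathcal F^\ell_{\rho,m,i},$$ $$\hat q^k_{I,i}=q^n_i-\sum_{\ell=1}^{k}a_{k,\ell}\sum_m\nu_m\delta_{x_m}\mathcal F^\ell_{q,m,i}+\sum_{\ell=1}^{k-1}a_{k,\ell}\sum_m\nu_m\rho^\ell_{E,i}\delta_{x_m}\mathcal S^\ell_{q,m,i};$$ then $\phi^k_I$ solves the linear system $$\sum_m\frac{\delta_{x_m}}{\Delta x_m}\Big(\big(\varepsilon^2+\Delta t^2a_{k,k}^2\rho^k_{E,i}\big)\frac{\delta_{x_m}}{\Delta x_m}\phi^k_{I,i}\Big)=\hat\rho^k_{I,i}-a_{k,k}\sum_m\nu_m\delta_{x_m}\hat q^k_{I,m,i}-1,$$ and $$q^k_{I,i}=\hat q^k_{I,i}+a_{k,k}\sum_m\nu_m\rho^k_{E,i}\,\delta_{x_m}\phi^k_{I,i}\,e_m,$$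 $$\rho^k_{I,i}=\hat\rho^k_{I,i}-a_{k,k}\sum_m\nu_m\delta_{x_m}q^k_{I,m,i}+a_{k,k}\sum_m\nu_m\delta_{x_m}\mathcal G^k_{I,m,i}.$$ The update is $(\rho^{n+1}_i,q^{n+1}_i,\phi^{n+1}_i)=(\rho^s_{I,i},q^s_{I,i},\phi^s_{I,i})$. The analysis is formal: all stage values have limits as $\varepsilon\to0$, denoted by the subscript $(0)$, and $u_{(0)}=q_{(0)}/\rho_{(0)}$. For a velocity grid function $u$ let $\mathcal D(u)_i=\sum_m\frac1{\Delta x_m}\delta_{x_m}\mathcal F_{q,m,i}$, with $\mathcal F_{q,m}$ the Rusanov-type numerical momentum flux evaluated for $\rho_E\equiv1$, $q_E=u$, i.e. $$\mathcal F_{q,m,i+\frac12e_m}=\tfrac12\big(u^+_{m,i+\frac12e_m}u^+_{i+\frac12e_m}+u^-_{m,i+\frac12e_m}u^-_{i+\frac12e_m}\big)+p(1)e_m-\max\big(|u^-_{m,i+\frac12e_m}|,|u^+_{m,i+\frac12e_m}|\big)\big(u^+_{i+\frac12e_m}-u^-_{i+\frac12e_m}\big)$$ (a discretisation of $\nabla\cdot(u\otimes u)$). "Transforms to an $s$-stage scheme for the incompressible limit system" means that for $k=1,\dots,s$ the limits satisfy $\rho^k_{E,(0)}=\rho^k_{I,(0)}=1$, $$u^k_{E,(0)}=u^n_{(0)}-\Delta t\sum_{\ell=1}^{k-1}\tilde a_{k,\ell}\big[\mathcal D(u^\ell_{E,(0)})-\hat\nabla\phi^\ell_{I,(0)}\big],\quad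 u^k_{I,(0)}=u^n_{(0)}-\Delta t\sum_{\ell=1}^{k}a_{k,\ell}\big[\mathcal D(u^\ell_{E,(0)})-\hat\nabla\phi^\ell_{I,(0)}\big],$$ $$\hat\nabla\cdot\hat\nabla\phi^k_{I,(0)}=\hat\nabla\cdot\mathcal D(u^k_{E,(0)}),$$ with the limit of the update equal to the limit of the last implicit stage; this is a discretisation of the reformulated incompressible Euler system.
   Formalization: The formal theorem adds two conditions without which the claim fails: all diagonal entries a_{k,k} of the implicit matrix A are nonzero, and the slopes of the piecewise linear reconstruction depend continuously on the grid function (under cellwise convergence). *)

theory Defs
  imports "HOL-Analysis.Analysis"
begin

section \<open>Grid functions and central differences\<close>

text \<open>
  Cells are indexed by integer triples, space directions by the three-element type 3.
  Periodic grid functions are a special case of functions on all cells.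
  A quantity living on the interfaces with half-integer index is stored, for every direction m,
  as a function of the cell to its left: the value at i + e_m/2 is \<open>f m i\<close> and the value
  at i - e_m/2 is \<open>f m (i - unit_cell m)\<close>.
\<close>

type_synonym cell = "int ^ 3"
type_synonym 'a grid = "cell \<Rightarrow> 'a"

definition unit_cell :: "3 \<Rightarrow> cell" where
  "unit_cell m = axis m 1"

definition unit_vec :: "3 \<Rightarrow> real ^ 3" where
  "unit_vec m = axis m 1"

definition face_diff :: "3 \<Rightarrow> 'a grid \<Rightarrow> 'a::real_vector grid" where
  "face_diff m f i = f i - f (i - unit_cell m)"

definition face_avg :: "3 \<Rightarrow> 'a grid \<Rightarrow> 'a::real_vector grid" where
  "face_avg m w i = (1/2) *\<^sub>R (w (i + unit_cell m) + w i)"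

text \<open>The operator delta applied to a cell grid function, via interface averages.\<close>

definition cell_diff :: "3 \<Rightarrow> 'a grid \<Rightarrow> 'a::real_vector grid" where
  "cell_diff m w = face_diff m (face_avg m w)"

lemma cell_diff_eq:
  "cell_diff m w i = (1/2) *\<^sub>R (w (i + unit_cell m) - w (i - unit_cell m))"
  by (simp add: cell_diff_def face_diff_def face_avg_def algebra_simps)

definition grad_h :: "real ^ 3 \<Rightarrow> real grid \<Rightarrow> (real ^ 3) grid" where
  "grad_h dx w i = (\<chi> m. cell_diff m w i / dx $ m)"

definition div_h :: "real ^ 3 \<Rightarrow> (real ^ 3) grid \<Rightarrow> real grid" where
  "div_h dx q i = (\<Sum>m\<in>UNIV. cell_diff m (\<lambda>j. q j $ m) i / dx $ m)"


section \<open>Parameters\<close>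

text \<open>
  \<open>slope P m w i\<close> is the slope in direction m, in cell i, of the piecewise linear
  reconstruction of the scalar grid function w.
\<close>

record params =
  mesh :: "real ^ 3"
  dt :: real
  gam :: real
  slope :: "3 \<Rightarrow> real grid \<Rightarrow> real grid"

text \<open>
  Stages are numbered from 1 to \<open>nstages\<close>; entries with other indices are irrelevant.
  \<open>Aex\<close> is the explicit matrix, \<open>Aim\<close> the diagonally implicit one, \<open>wt\<close> the weight vector.
\<close>

record tableau =
  nstages :: nat
  Aex :: "nat \<Rightarrow> nat \<Rightarrow> real"
  Aim :: "nat \<Rightarrow> nat \<Rightarrow> real"
  wt :: "nat \<Rightarrow> real"

text \<open>
  The two conditions on the slopes: constants are reproduced, and the slopes depend continuously
  on the grid function. Continuity refers to the product topology on functions, i.e. to pointwise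
  convergence of grid functions; it is what allows a reconstruction of stage values to pass to the
  limit, and holds for every continuous limiter acting on finitely many neighbouring differences.
\<close>

definition admissible_params :: "params \<Rightarrow> bool" where
  "admissible_params P \<longleftrightarrow>
     (\<forall>m. mesh P $ m > 0) \<and> dt P > 0 \<and> gam P > 1 \<and>
     (\<forall>m c. slope P m (\<lambda>_. c) = (\<lambda>_. 0)) \<and>
     (\<forall>m. continuous_on UNIV (slope P m))"

definition imex_dirk :: "tableau \<Rightarrow> bool" where
  "imex_dirk T \<longleftrightarrow> nstages T \<ge> 1 \<and>
     (\<forall>k\<in>{1..nstages T}. \<forall>l\<in>{1..nstages T}.
        (l \<ge> k \<longrightarrow> Aex T k l = 0) \<and> (l > k \<longrightarrow> Aim T k l = 0))"

definition stiffly_accurate :: "tableau \<Rightarrow> bool" where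
  "stiffly_accurate T \<longleftrightarrow> (\<forall>l\<in>{1..nstages T}. Aim T (nstages T) l = wt T l)"

definition cfl :: "params \<Rightarrow> 3 \<Rightarrow> real" where
  "cfl P m = dt P / mesh P $ m"


section \<open>Numerical fluxes\<close>

definition rec_left :: "params \<Rightarrow> 3 \<Rightarrow> real grid \<Rightarrow> real grid" where
  "rec_left P m w i = w i + mesh P $ m / 2 * slope P m w i"

definition rec_right :: "params \<Rightarrow> 3 \<Rightarrow> real grid \<Rightarrow> real grid" where
  "rec_right P m w i = w (i + unit_cell m) - mesh P $ m / 2 * slope P m w (i + unit_cell m)"

definition vrec_left :: "params \<Rightarrow> 3 \<Rightarrow> (real ^ 3) grid \<Rightarrow> (real ^ 3) grid" where
  "vrec_left P m q i = (\<chi> j. rec_left P m (\<lambda>c. q c $ j) i)"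

definition vrec_right :: "params \<Rightarrow> 3 \<Rightarrow> (real ^ 3) grid \<Rightarrow> (real ^ 3) grid" where
  "vrec_right P m q i = (\<chi> j. rec_right P m (\<lambda>c. q c $ j) i)"

definition pressure :: "params \<Rightarrow> real \<Rightarrow> real" where
  "pressure P r = r powr gam P"

definition phys_flux_q :: "params \<Rightarrow> 3 \<Rightarrow> real \<Rightarrow> real ^ 3 \<Rightarrow> real ^ 3" where
  "phys_flux_q P m r q = (q $ m / r) *\<^sub>R q + pressure P r *\<^sub>R unit_vec m"

definition flux_rho :: "3 \<Rightarrow> (real ^ 3) grid \<Rightarrow> real grid" where
  "flux_rho m q = face_avg m (\<lambda>j. q j $ m)"

definition diffusion :: "params \<Rightarrow> 3 \<Rightarrow> real grid \<Rightarrow> (real ^ 3) grid \<Rightarrow> real grid" where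
  "diffusion P m r q i =
     2 * max \<bar>vrec_left P m q i $ m / rec_left P m r i\<bar> \<bar>vrec_right P m q i $ m / rec_right P m r i\<bar>"

definition flux_q :: "params \<Rightarrow> 3 \<Rightarrow> real grid \<Rightarrow> (real ^ 3) grid \<Rightarrow> (real ^ 3) grid" where
  "flux_q P m r q i =
     (1/2) *\<^sub>R (phys_flux_q P m (rec_right P m r i) (vrec_right P m q i)
               + phys_flux_q P m (rec_left P m r i) (vrec_left P m q i))
     - (diffusion P m r q i / 2) *\<^sub>R (vrec_right P m q i - vrec_left P m q i)"

definition flux_S :: "3 \<Rightarrow> real grid \<Rightarrow> (real ^ 3) grid" where
  "flux_S m phi = face_avg m (\<lambda>j. phi j *\<^sub>R unit_vec m)"

definition flux_G :: "params \<Rightarrow> 3 \<Rightarrow> real grid \<Rightarrow> real grid" where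
  "flux_G P m r i = (1 / cfl P m) * (r (i + unit_cell m) - r i)"


section \<open>The fully discrete scheme\<close>

record stages =
  rho_E :: "nat \<Rightarrow> real grid"
  q_E :: "nat \<Rightarrow> (real ^ 3) grid"
  phi_I :: "nat \<Rightarrow> real grid"
  q_I :: "nat \<Rightarrow> (real ^ 3) grid"
  rho_I :: "nat \<Rightarrow> real grid"

definition hat_rho :: "params \<Rightarrow> tableau \<Rightarrow> real grid \<Rightarrow> stages \<Rightarrow> nat \<Rightarrow> real grid" where
  "hat_rho P T rhon Z k i =
     rhon i - (\<Sum>l\<in>{1..<k}. Aim T k l * (\<Sum>m\<in>UNIV. cfl P m * face_diff m (flux_rho m (q_I Z l)) i))"

definition hat_q :: "params \<Rightarrow> tableau \<Rightarrow> (real ^ 3) grid \<Rightarrow> stages \<Rightarrow> nat \<Rightarrow> (real ^ 3) grid" where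
  "hat_q P T qn Z k i =
     qn i
     - (\<Sum>l\<in>{1..k}. Aim T k l *\<^sub>R
          (\<Sum>m\<in>UNIV. cfl P m *\<^sub>R face_diff m (flux_q P m (rho_E Z l) (q_E Z l)) i))
     + (\<Sum>l\<in>{1..<k}. Aim T k l *\<^sub>R
          (\<Sum>m\<in>UNIV. (cfl P m * rho_E Z l i) *\<^sub>R face_diff m (flux_S m (phi_I Z l)) i))"

definition scheme_stage ::
  "params \<Rightarrow> tableau \<Rightarrow> real \<Rightarrow> real grid \<Rightarrow> (real ^ 3) grid \<Rightarrow> stages \<Rightarrow> nat \<Rightarrow> bool" where
  "scheme_stage P T \<epsilon> rhon qn Z k \<longleftrightarrow> (\<forall>i.
     rho_E Z k i =
       rhon i - (\<Sum>l\<in>{1..<k}. Aex T k l *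
                  (\<Sum>m\<in>UNIV. cfl P m * face_diff m (flux_rho m (q_I Z l)) i)) \<and>
     q_E Z k i =
       qn i
       - (\<Sum>l\<in>{1..<k}. Aex T k l *\<^sub>R
            (\<Sum>m\<in>UNIV. cfl P m *\<^sub>R face_diff m (flux_q P m (rho_E Z l) (q_E Z l)) i))
       + (\<Sum>l\<in>{1..<k}. Aex T k l *\<^sub>R
            (\<Sum>m\<in>UNIV. (cfl P m * rho_E Z l i) *\<^sub>R face_diff m (flux_S m (phi_I Z l)) i)) \<and>
     (\<Sum>m\<in>UNIV. cell_diff m (\<lambda>j. (\<epsilon>\<^sup>2 + (dt P)\<^sup>2 * (Aim T k k)\<^sup>2 * rho_E Z k j)
                                  * (cell_diff m (phi_I Z k) j / mesh P $ m)) i / mesh P $ m) =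
       hat_rho P T rhon Z k i
       - Aim T k k * (\<Sum>m\<in>UNIV. cfl P m * cell_diff m (\<lambda>j. hat_q P T qn Z k j $ m) i) - 1 \<and>
     q_I Z k i =
       hat_q P T qn Z k i
       + Aim T k k *\<^sub>R (\<Sum>m\<in>UNIV. (cfl P m * rho_E Z k i * cell_diff m (phi_I Z k) i) *\<^sub>R unit_vec m) \<and>
     rho_I Z k i =
       hat_rho P T rhon Z k i
       - Aim T k k * (\<Sum>m\<in>UNIV. cfl P m * cell_diff m (\<lambda>j. q_I Z k j $ m) i)
       + Aim T k k * (\<Sum>m\<in>UNIV. cfl P m * face_diff m (flux_G P m (rho_E Z k)) i))"

text \<open>
  One time step from the data \<open>rhon\<close>, \<open>qn\<close> to the update \<open>rho'\<close>, \<open>q'\<close>, \<open>phi'\<close> with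
  the stage values Z. The potential is only required to be some solution of its linear system.
\<close>

definition scheme_step ::
  "params \<Rightarrow> tableau \<Rightarrow> real \<Rightarrow> real grid \<Rightarrow> (real ^ 3) grid \<Rightarrow> stages
   \<Rightarrow> real grid \<Rightarrow> (real ^ 3) grid \<Rightarrow> real grid \<Rightarrow> bool" where
  "scheme_step P T \<epsilon> rhon qn Z rho' q' phi' \<longleftrightarrow>
     (\<forall>k\<in>{1..nstages T}. scheme_stage P T \<epsilon> rhon qn Z k) \<and>
     rho' = rho_I Z (nstages T) \<and> q' = q_I Z (nstages T) \<and> phi' = phi_I Z (nstages T)"


section \<open>The limit as the Debye length tends to zero\<close>

definition well_prepared ::
  "params \<Rightarrow> (real \<Rightarrow> real grid) \<Rightarrow> (real \<Rightarrow> (real ^ 3) grid)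
   \<Rightarrow> real grid \<Rightarrow> (real ^ 3) grid \<Rightarrow> real grid \<Rightarrow> (real ^ 3) grid \<Rightarrow> bool" where
  "well_prepared P rhon qn rhon0 qn0 rhon2 qn2 \<longleftrightarrow>
     (\<forall>\<epsilon>>0. \<forall>i. rhon \<epsilon> i = rhon0 i + \<epsilon>\<^sup>2 * rhon2 i \<and> qn \<epsilon> i = qn0 i + \<epsilon>\<^sup>2 *\<^sub>R qn2 i) \<and>
     (\<forall>i. rhon0 i = 1 \<and> div_h (mesh P) qn0 i = 0)"

text \<open>The stage values \<open>Z \<epsilon>\<close> have the limits \<open>Z0\<close>, cell by cell.\<close>

definition stages_tendsto :: "tableau \<Rightarrow> (real \<Rightarrow> stages) \<Rightarrow> stages \<Rightarrow> bool" where
  "stages_tendsto T Z Z0 \<longleftrightarrow> (\<forall>k\<in>{1..nstages T}. \<forall>i.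
     ((\<lambda>\<epsilon>. rho_E (Z \<epsilon>) k i) \<longlongrightarrow> rho_E Z0 k i) (at_right 0) \<and>
     ((\<lambda>\<epsilon>. q_E (Z \<epsilon>) k i) \<longlongrightarrow> q_E Z0 k i) (at_right 0) \<and>
     ((\<lambda>\<epsilon>. phi_I (Z \<epsilon>) k i) \<longlongrightarrow> phi_I Z0 k i) (at_right 0) \<and>
     ((\<lambda>\<epsilon>. q_I (Z \<epsilon>) k i) \<longlongrightarrow> q_I Z0 k i) (at_right 0) \<and>
     ((\<lambda>\<epsilon>. rho_I (Z \<epsilon>) k i) \<longlongrightarrow> rho_I Z0 k i) (at_right 0))"

definition velocity :: "real grid \<Rightarrow> (real ^ 3) grid \<Rightarrow> (real ^ 3) grid" where
  "velocity r q i = q i /\<^sub>R r i"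

definition convection_h :: "params \<Rightarrow> (real ^ 3) grid \<Rightarrow> (real ^ 3) grid" where
  "convection_h P u i = (\<Sum>m\<in>UNIV. (1 / mesh P $ m) *\<^sub>R face_diff m (flux_q P m (\<lambda>_. 1) u) i)"

lemma flux_q_unit_density:
  assumes "admissible_params P"
  shows "flux_q P m (\<lambda>_. 1) u i =
     (1/2) *\<^sub>R (vrec_right P m u i $ m *\<^sub>R vrec_right P m u i
               + vrec_left P m u i $ m *\<^sub>R vrec_left P m u i)
     + pressure P 1 *\<^sub>R unit_vec m
     - max \<bar>vrec_left P m u i $ m\<bar> \<bar>vrec_right P m u i $ m\<bar>
         *\<^sub>R (vrec_right P m u i - vrec_left P m u i)"
proof -
  have "rec_left P m (\<lambda>_. 1) i = 1" "rec_right P m (\<lambda>_. 1) i = 1"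
    using assms by (simp_all add: admissible_params_def rec_left_def rec_right_def)
  then show ?thesis
    by (simp add: flux_q_def phys_flux_q_def diffusion_def vec_eq_iff field_simps)
qed

text \<open>
  The s-stage scheme for the reformulated incompressible Euler system, satisfied by the limits
  \<open>Z0\<close> of the stage values and the limits \<open>rhon0\<close>, \<open>qn0\<close> of the data.
\<close>

definition incompressible_limit_scheme ::
  "params \<Rightarrow> tableau \<Rightarrow> real grid \<Rightarrow> (real ^ 3) grid \<Rightarrow> stages \<Rightarrow> bool" where
  "incompressible_limit_scheme P T rhon0 qn0 Z0 \<longleftrightarrow>
     (let un = velocity rhon0 qn0;
          uE = (\<lambda>k. velocity (rho_E Z0 k) (q_E Z0 k));
          uI = (\<lambda>k. velocity (rho_I Z0 k) (q_I Z0 k))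
      in \<forall>k\<in>{1..nstages T}. \<forall>i.
        rho_E Z0 k i = 1 \<and> rho_I Z0 k i = 1 \<and>
        uE k i = un i - dt P *\<^sub>R (\<Sum>l\<in>{1..<k}. Aex T k l *\<^sub>R
                   (convection_h P (uE l) i - grad_h (mesh P) (phi_I Z0 l) i)) \<and>
        uI k i = un i - dt P *\<^sub>R (\<Sum>l\<in>{1..k}. Aim T k l *\<^sub>R
                   (convection_h P (uE l) i - grad_h (mesh P) (phi_I Z0 l) i)) \<and>
        div_h (mesh P) (grad_h (mesh P) (phi_I Z0 k)) i = div_h (mesh P) (convection_h P (uE k)) i)"

end

theory Submission
  imports Defs
begin

text \<open>
  Why the scheme is asymptotic preserving: for a fixed mesh and time step every equation of a
  stage makes sense at \<open>\<epsilon> = 0\<close>, and its terms are continuous in the stage values near density one.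
  Hence the limits of the stage values solve the same scheme with \<open>\<epsilon> = 0\<close>
  (\<open>scheme_stage_limit\<close>). The delicate term is the momentum flux, where the reconstructed
  density stands in a denominator and in a power; it is continuous there because reconstructions
  reproduce the constant one. Consequently the limit of the explicit density has to be identified
  before the flux of the same stage can be treated (\<open>scheme_stage_rho_E_limit\<close>).

  At \<open>\<epsilon> = 0\<close> and density one the elliptic equation has lost its Poisson part \<open>\<epsilon>\<^sup>2 \<Delta>\<phi>\<close>. As a
  face difference of face averages is a central difference, what is left says that \<open>a\<^sub>k\<^sub>k \<Delta>t\<close>
  times the discrete divergence of the momentum update \<open>q\<^sub>I = hat q + a\<^sub>k\<^sub>k \<Delta>t grad \<phi>\<close> equals the
  defect of the predicted density from one. By induction over the stages that defect vanishes,
  because it is a combination of divergences of earlier stage momenta; since \<open>a\<^sub>k\<^sub>k\<close> is nonzero, the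
  momentum of the stage is divergence free, its implicit density is one, and so is the explicit
  density of the next stage (\<open>zero_debye_div_q_I\<close>, \<open>unit_density_rho_I\<close>).

  With all densities equal to one, the momentum equations are the velocity equations of the limit
  scheme. Taking their divergence leaves
  \<open>\<Sum>\<^sub>l\<^sub>\<le>\<^sub>k a\<^sub>k\<^sub>l (div D(u\<^sup>l) - div grad \<phi>\<^sup>l) = 0\<close> for every stage, a triangular system with nonzero
  diagonal, whose only solution is zero: this is the Poisson equation of every stage
  (\<open>poisson_of_div_free_stages\<close>).
\<close>

section \<open>Continuity of the discrete operators under cellwise convergence\<close>

lemma tendsto_face_diff:
  fixes w0 :: "'a::real_normed_vector grid"
  assumes "\<And>i. ((\<lambda>e. w e i) \<longlongrightarrow> w0 i) F"
  shows "((\<lambda>e. face_diff m (w e) i) \<longlongrightarrow> face_diff m w0 i) F"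
  unfolding face_diff_def by (intro tendsto_intros assms)

lemma tendsto_face_avg:
  fixes w0 :: "'a::real_normed_vector grid"
  assumes "\<And>i. ((\<lambda>e. w e i) \<longlongrightarrow> w0 i) F"
  shows "((\<lambda>e. face_avg m (w e) i) \<longlongrightarrow> face_avg m w0 i) F"
  unfolding face_avg_def by (intro tendsto_intros assms)

lemma tendsto_cell_diff:
  fixes w0 :: "'a::real_normed_vector grid"
  assumes "\<And>i. ((\<lambda>e. w e i) \<longlongrightarrow> w0 i) F"
  shows "((\<lambda>e. cell_diff m (w e) i) \<longlongrightarrow> cell_diff m w0 i) F"
  unfolding cell_diff_def by (intro tendsto_face_diff tendsto_face_avg assms)

lemma tendsto_div_h:
  assumes "\<And>i. ((\<lambda>e. q e i) \<longlongrightarrow> q0 i) F"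
  shows "((\<lambda>e. div_h dx (q e) i) \<longlongrightarrow> div_h dx q0 i) F"
  unfolding div_h_def divide_inverse
  by (intro tendsto_intros tendsto_cell_diff assms)

lemma tendsto_flux_rho:
  assumes "\<And>i. ((\<lambda>e. q e i) \<longlongrightarrow> q0 i) F"
  shows "((\<lambda>e. flux_rho m (q e) i) \<longlongrightarrow> flux_rho m q0 i) F"
  unfolding flux_rho_def by (intro tendsto_face_avg tendsto_vec_nth assms)

lemma tendsto_flux_S:
  assumes "\<And>i. ((\<lambda>e. phi e i) \<longlongrightarrow> phi0 i) F"
  shows "((\<lambda>e. flux_S m (phi e) i) \<longlongrightarrow> flux_S m phi0 i) F"
  unfolding flux_S_def by (intro tendsto_face_avg tendsto_intros assms)

lemma tendsto_flux_G:
  assumes "\<And>i. ((\<lambda>e. r e i) \<longlongrightarrow> r0 i) F"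
  shows "((\<lambda>e. flux_G P m (r e) i) \<longlongrightarrow> flux_G P m r0 i) F"
  unfolding flux_G_def by (intro tendsto_intros assms)

text \<open>
  Convergence cell by cell is convergence in the product topology, the one in which slopes are
  continuous.
\<close>

lemma tendsto_slope:
  assumes "admissible_params P" "\<And>i. ((\<lambda>e. w e i) \<longlongrightarrow> w0 i) F"
  shows "((\<lambda>e. slope P m (w e) i) \<longlongrightarrow> slope P m w0 i) F"
proof -
  have componentwise: "(f \<longlongrightarrow> f0) F \<longleftrightarrow> (\<forall>i. ((\<lambda>e. f e i) \<longlongrightarrow> f0 i) F)"
    for f :: "'a \<Rightarrow> real grid" and f0
    using limitin_componentwise[of "\<lambda>_. euclidean" "UNIV :: cell set" f f0 F]
    by (simp add: euclidean_product_topology)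
  have "(w \<longlongrightarrow> w0) F"
    using assms(2) by (simp only: componentwise simp_thms)
  moreover have "continuous_on UNIV (slope P m)"
    using assms(1) by (simp add: admissible_params_def)
  ultimately have "((\<lambda>e. slope P m (w e)) \<longlongrightarrow> slope P m w0) F"
    using continuous_on_tendsto_compose by fastforce
  then show ?thesis
    by (simp only: componentwise)
qed

lemma tendsto_rec:
  assumes "admissible_params P" "\<And>i. ((\<lambda>e. w e i) \<longlongrightarrow> w0 i) F"
  shows "((\<lambda>e. rec_left P m (w e) i) \<longlongrightarrow> rec_left P m w0 i) F"
    and "((\<lambda>e. rec_right P m (w e) i) \<longlongrightarrow> rec_right P m w0 i) F"
  unfolding rec_left_def rec_right_def
  by (intro tendsto_intros tendsto_slope assms)+

lemma tendsto_vrec: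
  assumes "admissible_params P" "\<And>i. ((\<lambda>e. q e i) \<longlongrightarrow> q0 i) F"
  shows "((\<lambda>e. vrec_left P m (q e) i) \<longlongrightarrow> vrec_left P m q0 i) F"
    and "((\<lambda>e. vrec_right P m (q e) i) \<longlongrightarrow> vrec_right P m q0 i) F"
  unfolding vrec_left_def vrec_right_def
  by (intro tendsto_vec_lambda tendsto_rec tendsto_vec_nth assms)+

lemma rec_unit_density:
  assumes "admissible_params P"
  shows "rec_left P m (\<lambda>_. 1) i = 1" "rec_right P m (\<lambda>_. 1) i = 1"
  using assms by (simp_all add: admissible_params_def rec_left_def rec_right_def)

text \<open>
  The flux divides by the reconstructed density and raises it to the power \<open>\<gamma>\<close>; it is continuous
  at the constant density one because the reconstruction of that density is one, hence nonzero.
\<close>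

lemma tendsto_flux_q:
  assumes P: "admissible_params P"
    and r: "\<And>i. ((\<lambda>e. r e i) \<longlongrightarrow> 1) F"
    and q: "\<And>i. ((\<lambda>e. q e i) \<longlongrightarrow> q0 i) F"
  shows "((\<lambda>e. flux_q P m (r e) (q e) i) \<longlongrightarrow> flux_q P m (\<lambda>_. 1) q0 i) F"
  unfolding flux_q_def phys_flux_q_def diffusion_def pressure_def
  by (intro tendsto_intros tendsto_max tendsto_powr tendsto_vrec tendsto_rec P q r)
     (simp_all add: rec_unit_density[OF P])

section \<open>Passing to the limit in a stage\<close>

lemma limit_eq_of_eventually_eq:
  fixes a b :: "'a::t2_space"
  assumes "F \<noteq> bot" "\<forall>\<^sub>F e in F. f e = g e" "(f \<longlongrightarrow> a) F" "(g \<longlongrightarrow> b) F"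
  shows "a = b"
  using assms tendsto_cong tendsto_unique by metis

lemma tendsto_hat_rho:
  assumes "\<And>i. ((\<lambda>e. rhon e i) \<longlongrightarrow> rhon0 i) F"
    and "\<And>l i. l \<in> {1..<k} \<Longrightarrow> ((\<lambda>e. q_I (Z e) l i) \<longlongrightarrow> q_I Z0 l i) F"
  shows "((\<lambda>e. hat_rho P T (rhon e) (Z e) k i) \<longlongrightarrow> hat_rho P T rhon0 Z0 k i) F"
  unfolding hat_rho_def by (intro tendsto_intros tendsto_face_diff tendsto_flux_rho assms)

lemma tendsto_hat_q:
  assumes P: "admissible_params P"
    and qn: "\<And>i. ((\<lambda>e. qn e i) \<longlongrightarrow> qn0 i) F"
    and rE: "\<And>l i. l \<in> {1..k} \<Longrightarrow> ((\<lambda>e. rho_E (Z e) l i) \<longlongrightarrow> 1) F"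
    and rE0: "\<And>l. l \<in> {1..k} \<Longrightarrow> rho_E Z0 l = (\<lambda>_. 1)"
    and qE: "\<And>l i. l \<in> {1..k} \<Longrightarrow> ((\<lambda>e. q_E (Z e) l i) \<longlongrightarrow> q_E Z0 l i) F"
    and ph: "\<And>l i. l \<in> {1..k} \<Longrightarrow> ((\<lambda>e. phi_I (Z e) l i) \<longlongrightarrow> phi_I Z0 l i) F"
  shows "((\<lambda>e. hat_q P T (qn e) (Z e) k i) \<longlongrightarrow> hat_q P T qn0 Z0 k i) F"
proof -
  have "((\<lambda>e. hat_q P T (qn e) (Z e) k i) \<longlongrightarrow>
     qn0 i
     - (\<Sum>l\<in>{1..k}. Aim T k l *\<^sub>R
          (\<Sum>m\<in>UNIV. cfl P m *\<^sub>R face_diff m (flux_q P m (\<lambda>_. 1) (q_E Z0 l)) i))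
     + (\<Sum>l\<in>{1..<k}. Aim T k l *\<^sub>R
          (\<Sum>m\<in>UNIV. (cfl P m * 1) *\<^sub>R face_diff m (flux_S m (phi_I Z0 l)) i))) F"
    unfolding hat_q_def
    by (intro tendsto_intros tendsto_face_diff tendsto_flux_q tendsto_flux_S P qn rE qE ph) auto
  then show ?thesis
    by (simp add: hat_q_def rE0)
qed

text \<open>
  The explicit density only involves fluxes linear in earlier momenta, so its equation passes to the
  limit without any knowledge of the limit density. This is what provides the density hypothesis
  of \<open>scheme_stage_limit\<close> below.
\<close>

lemma scheme_stage_rho_E_limit:
  assumes st: "\<forall>\<^sub>F \<epsilon> in F. scheme_stage P T \<epsilon> (rhon \<epsilon>) (qn \<epsilon>) (Z \<epsilon>) k"
    and F: "F \<noteq> bot"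
    and rn: "\<And>i. ((\<lambda>e. rhon e i) \<longlongrightarrow> rhon0 i) F"
    and rE: "\<And>i. ((\<lambda>e. rho_E (Z e) k i) \<longlongrightarrow> rho_E Z0 k i) F"
    and qI: "\<And>l i. l \<in> {1..<k} \<Longrightarrow> ((\<lambda>e. q_I (Z e) l i) \<longlongrightarrow> q_I Z0 l i) F"
  shows "rho_E Z0 k i = rhon0 i - (\<Sum>l\<in>{1..<k}. Aex T k l *
                  (\<Sum>m\<in>UNIV. cfl P m * face_diff m (flux_rho m (q_I Z0 l)) i))"
proof (rule limit_eq_of_eventually_eq[OF F _ rE])
  show "\<forall>\<^sub>F e in F. rho_E (Z e) k i = rhon e i - (\<Sum>l\<in>{1..<k}. Aex T k l *
                  (\<Sum>m\<in>UNIV. cfl P m * face_diff m (flux_rho m (q_I (Z e) l)) i))"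
    using st unfolding scheme_stage_def by eventually_elim blast
qed (intro tendsto_intros tendsto_face_diff tendsto_flux_rho rn qI)

text \<open>
  The limit \<open>\<epsilon>0\<close> may be zero: the coefficient of the elliptic operator is continuous in \<open>\<epsilon>\<close>, so the
  equation survives and merely loses its Poisson part.
\<close>

lemma scheme_stage_limit:
  assumes st: "\<forall>\<^sub>F \<epsilon> in F. scheme_stage P T \<epsilon> (rhon \<epsilon>) (qn \<epsilon>) (Z \<epsilon>) k"
    and F: "F \<noteq> bot" and eps: "((\<lambda>\<epsilon>. \<epsilon>) \<longlongrightarrow> \<epsilon>0) F"
    and P: "admissible_params P" and k: "1 \<le> k"
    and rn: "\<And>i. ((\<lambda>e. rhon e i) \<longlongrightarrow> rhon0 i) F"
    and qn: "\<And>i. ((\<lambda>e. qn e i) \<longlongrightarrow> qn0 i) F"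
    and rE: "\<And>l i. l \<in> {1..k} \<Longrightarrow> ((\<lambda>e. rho_E (Z e) l i) \<longlongrightarrow> 1) F"
    and rE0: "\<And>l. l \<in> {1..k} \<Longrightarrow> rho_E Z0 l = (\<lambda>_. 1)"
    and qE: "\<And>l i. l \<in> {1..k} \<Longrightarrow> ((\<lambda>e. q_E (Z e) l i) \<longlongrightarrow> q_E Z0 l i) F"
    and ph: "\<And>l i. l \<in> {1..k} \<Longrightarrow> ((\<lambda>e. phi_I (Z e) l i) \<longlongrightarrow> phi_I Z0 l i) F"
    and qI: "\<And>l i. l \<in> {1..k} \<Longrightarrow> ((\<lambda>e. q_I (Z e) l i) \<longlongrightarrow> q_I Z0 l i) F"
    and rI: "\<And>i. ((\<lambda>e. rho_I (Z e) k i) \<longlongrightarrow> rho_I Z0 k i) F"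
  shows "scheme_stage P T \<epsilon>0 rhon0 qn0 Z0 k"
proof -
  have kk: "k \<in> {1..k}" using k by simp
  have less: "l \<in> {1..k}" if "l \<in> {1..<k}" for l using that by simp
  have rE': "\<And>i. ((\<lambda>e. rho_E (Z e) k i) \<longlongrightarrow> rho_E Z0 k i) F"
    using rE[OF kk] by (simp add: rE0[OF kk])
  have qI': "\<And>l i. l \<in> {1..<k} \<Longrightarrow> ((\<lambda>e. q_I (Z e) l i) \<longlongrightarrow> q_I Z0 l i) F"
    using qI by simp
  note hq = tendsto_hat_q[of P qn qn0 F k Z Z0, OF P qn rE rE0 qE ph]
  note hr = tendsto_hat_rho[of rhon rhon0 F k Z Z0, OF rn qI']
  have 1: "rho_E Z0 k i = rhon0 i - (\<Sum>l\<in>{1..<k}. Aex T k l *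
             (\<Sum>m\<in>UNIV. cfl P m * face_diff m (flux_rho m (q_I Z0 l)) i))" for i
    by (rule scheme_stage_rho_E_limit[OF st F rn rE' qI'])
  have 2: "q_E Z0 k i =
       qn0 i
       - (\<Sum>l\<in>{1..<k}. Aex T k l *\<^sub>R
            (\<Sum>m\<in>UNIV. cfl P m *\<^sub>R face_diff m (flux_q P m (\<lambda>_. 1) (q_E Z0 l)) i))
       + (\<Sum>l\<in>{1..<k}. Aex T k l *\<^sub>R
            (\<Sum>m\<in>UNIV. (cfl P m * 1) *\<^sub>R face_diff m (flux_S m (phi_I Z0 l)) i))" for i
  proof (rule limit_eq_of_eventually_eq[OF F _ qE[OF kk]])
    show "\<forall>\<^sub>F e in F. q_E (Z e) k i = qn e i
       - (\<Sum>l\<in>{1..<k}. Aex T k l *\<^sub>R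
            (\<Sum>m\<in>UNIV. cfl P m *\<^sub>R face_diff m (flux_q P m (rho_E (Z e) l) (q_E (Z e) l)) i))
       + (\<Sum>l\<in>{1..<k}. Aex T k l *\<^sub>R
            (\<Sum>m\<in>UNIV. (cfl P m * rho_E (Z e) l i) *\<^sub>R face_diff m (flux_S m (phi_I (Z e) l)) i))"
      using st unfolding scheme_stage_def by eventually_elim blast
  qed (intro tendsto_intros tendsto_face_diff tendsto_flux_q tendsto_flux_S P qn rE qE ph less; assumption)
  have 3: "(\<Sum>m\<in>UNIV. cell_diff m (\<lambda>j. (\<epsilon>0\<^sup>2 + (dt P)\<^sup>2 * (Aim T k k)\<^sup>2 * rho_E Z0 k j)
                                  * (cell_diff m (phi_I Z0 k) j / mesh P $ m)) i / mesh P $ m) =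
       hat_rho P T rhon0 Z0 k i
       - Aim T k k * (\<Sum>m\<in>UNIV. cfl P m * cell_diff m (\<lambda>j. hat_q P T qn0 Z0 k j $ m) i) - 1" for i
  proof (rule limit_eq_of_eventually_eq[OF F])
    show "\<forall>\<^sub>F e in F. (\<Sum>m\<in>UNIV. cell_diff m (\<lambda>j. (e\<^sup>2 + (dt P)\<^sup>2 * (Aim T k k)\<^sup>2 * rho_E (Z e) k j)
                                  * (cell_diff m (phi_I (Z e) k) j / mesh P $ m)) i / mesh P $ m) =
       hat_rho P T (rhon e) (Z e) k i
       - Aim T k k * (\<Sum>m\<in>UNIV. cfl P m * cell_diff m (\<lambda>j. hat_q P T (qn e) (Z e) k j $ m) i) - 1"
      using st unfolding scheme_stage_def by eventually_elim blast
  qed (unfold divide_inverse, 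
       (intro tendsto_intros tendsto_cell_diff hq hr eps rE' ph kk; assumption)+)
  have 4: "q_I Z0 k i = hat_q P T qn0 Z0 k i
       + Aim T k k *\<^sub>R (\<Sum>m\<in>UNIV. (cfl P m * rho_E Z0 k i * cell_diff m (phi_I Z0 k) i) *\<^sub>R unit_vec m)" for i
  proof (rule limit_eq_of_eventually_eq[OF F _ qI[OF kk]])
    show "\<forall>\<^sub>F e in F. q_I (Z e) k i = hat_q P T (qn e) (Z e) k i
       + Aim T k k *\<^sub>R (\<Sum>m\<in>UNIV. (cfl P m * rho_E (Z e) k i * cell_diff m (phi_I (Z e) k) i) *\<^sub>R unit_vec m)"
      using st unfolding scheme_stage_def by eventually_elim blast
  qed (intro tendsto_intros tendsto_cell_diff hq rE' ph kk; assumption)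
  have 5: "rho_I Z0 k i =
       hat_rho P T rhon0 Z0 k i
       - Aim T k k * (\<Sum>m\<in>UNIV. cfl P m * cell_diff m (\<lambda>j. q_I Z0 k j $ m) i)
       + Aim T k k * (\<Sum>m\<in>UNIV. cfl P m * face_diff m (flux_G P m (rho_E Z0 k)) i)" for i
  proof (rule limit_eq_of_eventually_eq[OF F _ rI])
    show "\<forall>\<^sub>F e in F. rho_I (Z e) k i =
       hat_rho P T (rhon e) (Z e) k i
       - Aim T k k * (\<Sum>m\<in>UNIV. cfl P m * cell_diff m (\<lambda>j. q_I (Z e) k j $ m) i)
       + Aim T k k * (\<Sum>m\<in>UNIV. cfl P m * face_diff m (flux_G P m (rho_E (Z e) k)) i)"
      using st unfolding scheme_stage_def by eventually_elim blast
  qed (intro tendsto_intros tendsto_cell_diff tendsto_face_diff tendsto_flux_G hr rE' qI kk; assumption)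
  show ?thesis
    unfolding scheme_stage_def
    using 1 2 3 4 5 by (simp add: rE0)
qed

section \<open>Linear structure of the discrete operators\<close>

lemma div_h_add: "div_h dx (\<lambda>j. q j + r j) i = div_h dx q i + div_h dx r i"
proof -
  have "cell_diff m (\<lambda>j. (q j + r j) $ m) i / dx $ m
      = cell_diff m (\<lambda>j. q j $ m) i / dx $ m + cell_diff m (\<lambda>j. r j $ m) i / dx $ m" for m
    by (simp add: cell_diff_eq add_divide_distrib[symmetric] distrib_left[symmetric])
  then show ?thesis by (simp add: div_h_def sum.distrib)
qed

lemma div_h_scaleR: "div_h dx (\<lambda>j. c *\<^sub>R q j) i = c * div_h dx q i"
  by (simp add: div_h_def cell_diff_eq sum_distrib_left right_diff_distrib mult.left_commute)

lemma div_h_diff: "div_h dx (\<lambda>j. q j - r j) i = div_h dx q i - div_h dx r i"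
  using div_h_add[of dx q "\<lambda>j. (-1) *\<^sub>R r j" i] by (simp only: div_h_scaleR) simp

lemma div_h_sum: "div_h dx (\<lambda>j. \<Sum>l\<in>A. q l j) i = (\<Sum>l\<in>A. div_h dx (q l) i)"
proof (induction A rule: infinite_finite_induct)
  case (insert x F)
  then show ?case by (simp add: div_h_add)
qed (simp_all add: div_h_def cell_diff_eq)

text \<open>
  The flux sums of the scheme are \<open>\<Delta>t\<close> times discrete divergences, convection terms and gradients.
  For the density flux and the potential this is where interface averages turn into the same
  central differences as in the elliptic equation; without it the divergences of the stages
  would not cancel.
\<close>

lemma cfl_sum_cell_diff:
  "(\<Sum>m\<in>UNIV. cfl P m * cell_diff m (\<lambda>j. q j $ m) i) = dt P * div_h (mesh P) q i"
  by (simp add: div_h_def cfl_def sum_distrib_left)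

lemma cfl_sum_flux_rho:
  "(\<Sum>m\<in>UNIV. cfl P m * face_diff m (flux_rho m q) i) = dt P * div_h (mesh P) q i"
  by (simp add: div_h_def cfl_def sum_distrib_left flux_rho_def cell_diff_def)

lemma cfl_sum_flux_q:
  "(\<Sum>m\<in>UNIV. cfl P m *\<^sub>R face_diff m (flux_q P m (\<lambda>_. 1) u) i) = dt P *\<^sub>R convection_h P u i"
  by (simp add: convection_h_def cfl_def scaleR_sum_right)

lemma cfl_sum_unit_vec:
  "(\<Sum>m\<in>UNIV. (cfl P m * cell_diff m phi i) *\<^sub>R unit_vec m) = dt P *\<^sub>R grad_h (mesh P) phi i"
  by (simp add: vec_eq_iff grad_h_def cfl_def unit_vec_def axis_def if_distrib cong: if_cong)

lemma face_diff_flux_S: "face_diff m (flux_S m phi) i = cell_diff m phi i *\<^sub>R unit_vec m"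
  by (simp add: flux_S_def cell_diff_eq face_diff_def face_avg_def algebra_simps)

lemma cfl_sum_flux_S:
  "(\<Sum>m\<in>UNIV. cfl P m *\<^sub>R face_diff m (flux_S m phi) i) = dt P *\<^sub>R grad_h (mesh P) phi i"
  using cfl_sum_unit_vec[of P phi i] by (simp add: face_diff_flux_S)

lemma div_h_grad_h:
  "div_h dx (grad_h dx phi) i = (\<Sum>m\<in>UNIV. cell_diff m (\<lambda>j. cell_diff m phi j / dx $ m) i / dx $ m)"
  by (simp add: div_h_def grad_h_def)

lemma cell_diff_const_mult: "cell_diff m (\<lambda>j. c * w j) i = c * cell_diff m w i" for w :: "real grid"
  by (simp add: cell_diff_eq algebra_simps)

section \<open>Stages of unit density and the elliptic equation at zero Debye length\<close>

lemma unit_density_hat_q: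
  assumes "\<And>l. l \<in> {1..k} \<Longrightarrow> rho_E Z l = (\<lambda>_. 1)"
  shows "hat_q P T qn Z k i = qn i
     - dt P *\<^sub>R (\<Sum>l\<in>{1..k}. Aim T k l *\<^sub>R convection_h P (q_E Z l) i)
     + dt P *\<^sub>R (\<Sum>l\<in>{1..<k}. Aim T k l *\<^sub>R grad_h (mesh P) (phi_I Z l) i)"
  by (simp add: hat_q_def assms cfl_sum_flux_q cfl_sum_flux_S scaleR_sum_right mult.commute)

lemma hat_rho_of_div_free_stages:
  assumes "\<And>l j. l \<in> {1..<k} \<Longrightarrow> div_h (mesh P) (q_I Z l) j = 0"
  shows "hat_rho P T rhon Z k i = rhon i"
  by (simp add: hat_rho_def cfl_sum_flux_rho assms)

lemma unit_density_q_E: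
  assumes "scheme_stage P T \<epsilon> rhon qn Z k"
    and "\<And>l. l \<in> {1..<k} \<Longrightarrow> rho_E Z l = (\<lambda>_. 1)"
  shows "q_E Z k i = qn i - dt P *\<^sub>R (\<Sum>l\<in>{1..<k}. Aex T k l *\<^sub>R
           (convection_h P (q_E Z l) i - grad_h (mesh P) (phi_I Z l) i))"
  using assms
  by (simp add: scheme_stage_def cfl_sum_flux_q cfl_sum_flux_S scaleR_sum_right mult.commute
      scaleR_diff_right sum_subtractf)

lemma unit_density_q_I_predictor:
  assumes "scheme_stage P T \<epsilon> rhon qn Z k" and "rho_E Z k = (\<lambda>_. 1)"
  shows "q_I Z k i = hat_q P T qn Z k i
           + (Aim T k k * dt P) *\<^sub>R grad_h (mesh P) (phi_I Z k) i"
  using assms by (simp add: scheme_stage_def cfl_sum_unit_vec)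

lemma unit_density_q_I:
  assumes "scheme_stage P T \<epsilon> rhon qn Z k" and "1 \<le> k"
    and "\<And>l. l \<in> {1..k} \<Longrightarrow> rho_E Z l = (\<lambda>_. 1)"
  shows "q_I Z k i = qn i - dt P *\<^sub>R (\<Sum>l\<in>{1..k}. Aim T k l *\<^sub>R
           (convection_h P (q_E Z l) i - grad_h (mesh P) (phi_I Z l) i))"
proof -
  have k: "{1..k} = insert k {1..<k}" using assms(2) by auto
  have "rho_E Z k = (\<lambda>_. 1)" using assms(2,3) by simp
  then have "q_I Z k i = hat_q P T qn Z k i + (Aim T k k * dt P) *\<^sub>R grad_h (mesh P) (phi_I Z k) i"
    by (rule unit_density_q_I_predictor[OF assms(1)])
  moreover have "hat_q P T qn Z k i = qn i
     - dt P *\<^sub>R (\<Sum>l\<in>{1..k}. Aim T k l *\<^sub>R convection_h P (q_E Z l) i)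
     + dt P *\<^sub>R (\<Sum>l\<in>{1..<k}. Aim T k l *\<^sub>R grad_h (mesh P) (phi_I Z l) i)"
    by (rule unit_density_hat_q) (rule assms(3))
  ultimately show ?thesis
    unfolding k by (simp add: algebra_simps sum_subtractf)
qed

text \<open>
  With \<open>\<epsilon> = 0\<close> and unit density the elliptic equation reads \<open>a\<^sup>2 \<Delta>t\<^sup>2 div grad \<phi> = - a \<Delta>t div (hat q)\<close>, that is,
  \<open>a \<Delta>t div q\<^sub>I = 0\<close>: the potential projects the predicted momentum onto divergence free fields.
\<close>

lemma zero_debye_div_q_I:
  assumes st: "scheme_stage P T 0 (\<lambda>_. 1) qn Z k"
    and P: "admissible_params P" and a: "Aim T k k \<noteq> 0"
    and rE: "rho_E Z k = (\<lambda>_. 1)"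
    and prev: "\<And>l j. l \<in> {1..<k} \<Longrightarrow> div_h (mesh P) (q_I Z l) j = 0"
  shows "div_h (mesh P) (q_I Z k) i = 0"
proof -
  let ?a = "Aim T k k" and ?G = "grad_h (mesh P) (phi_I Z k)" and ?q = "hat_q P T qn Z k"
  have hat_rho: "hat_rho P T (\<lambda>_. 1) Z k i = 1"
    by (rule hat_rho_of_div_free_stages) (rule prev)
  have "(\<Sum>m\<in>UNIV. cell_diff m (\<lambda>j. (0\<^sup>2 + (dt P)\<^sup>2 * ?a\<^sup>2 * rho_E Z k j)
           * (cell_diff m (phi_I Z k) j / mesh P $ m)) i / mesh P $ m)
        = hat_rho P T (\<lambda>_. 1) Z k i - ?a * (\<Sum>m\<in>UNIV. cfl P m * cell_diff m (\<lambda>j. ?q j $ m) i) - 1"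
    using st unfolding scheme_stage_def by blast
  then have "(\<Sum>m\<in>UNIV. cell_diff m (\<lambda>j. ((dt P)\<^sup>2 * ?a\<^sup>2)
           * (cell_diff m (phi_I Z k) j / mesh P $ m)) i / mesh P $ m)
        = - (?a * (dt P * div_h (mesh P) ?q i))"
    by (simp add: rE hat_rho cfl_sum_cell_diff)
  then have elliptic: "(dt P)\<^sup>2 * ?a\<^sup>2 * div_h (mesh P) ?G i = - (?a * (dt P * div_h (mesh P) ?q i))"
    unfolding cell_diff_const_mult by (simp add: div_h_grad_h sum_distrib_left)
  have "q_I Z k = (\<lambda>j. ?q j + (?a * dt P) *\<^sub>R ?G j)"
    using unit_density_q_I_predictor[OF st rE] by blast
  then have "div_h (mesh P) (q_I Z k) i = div_h (mesh P) ?q i + (?a * dt P) * div_h (mesh P) ?G i"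
    by (simp only: div_h_add div_h_scaleR)
  then have "(?a * dt P) * div_h (mesh P) (q_I Z k) i = 0"
    using elliptic by (simp add: algebra_simps power2_eq_square)
  moreover have "dt P \<noteq> 0" using P by (simp add: admissible_params_def)
  ultimately show ?thesis using a by simp
qed

lemma unit_density_rho_I:
  assumes "scheme_stage P T \<epsilon> (\<lambda>_. 1) qn Z k"
    and "rho_E Z k = (\<lambda>_. 1)"
    and "\<And>l j. l \<in> {1..<k} \<Longrightarrow> div_h (mesh P) (q_I Z l) j = 0"
    and "div_h (mesh P) (q_I Z k) i = 0"
  shows "rho_I Z k i = 1"
proof -
  have "rho_I Z k i = hat_rho P T (\<lambda>_. 1) Z k i
       - Aim T k k * (\<Sum>m\<in>UNIV. cfl P m * cell_diff m (\<lambda>j. q_I Z k j $ m) i)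
       + Aim T k k * (\<Sum>m\<in>UNIV. cfl P m * face_diff m (flux_G P m (rho_E Z k)) i)"
    using assms(1) unfolding scheme_stage_def by blast
  moreover have "hat_rho P T (\<lambda>_. 1) Z k i = 1"
    by (rule hat_rho_of_div_free_stages) (rule assms(3))
  ultimately show ?thesis
    using assms(2,4)
    by (simp add: cfl_sum_cell_diff flux_G_def face_diff_def)
qed

text \<open>
  The divergences of the momentum equations of all stages form a homogeneous triangular system for
  the residuals of the Poisson equations; its diagonal entries are nonzero.
\<close>

lemma poisson_of_div_free_stages:
  assumes P: "admissible_params P"
    and a: "\<And>k. k \<in> {1..s} \<Longrightarrow> Aim T k k \<noteq> 0"
    and qn: "\<And>i. div_h (mesh P) qn i = 0"
    and qI: "\<And>k i. k \<in> {1..s} \<Longrightarrow> q_I Z k i = qn i - dt P *\<^sub>R (\<Sum>l\<in>{1..k}. Aim T k l *\<^sub>R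
               (convection_h P (q_E Z l) i - grad_h (mesh P) (phi_I Z l) i))"
    and div: "\<And>k i. k \<in> {1..s} \<Longrightarrow> div_h (mesh P) (q_I Z k) i = 0"
  shows "k \<in> {1..s} \<Longrightarrow> div_h (mesh P) (grad_h (mesh P) (phi_I Z k)) i
                         = div_h (mesh P) (convection_h P (q_E Z k)) i"
proof (induction k rule: less_induct)
  case (less k)
  let ?r = "\<lambda>l. div_h (mesh P) (convection_h P (q_E Z l)) i
              - div_h (mesh P) (grad_h (mesh P) (phi_I Z l)) i"
  have "q_I Z k = (\<lambda>j. qn j - dt P *\<^sub>R (\<Sum>l\<in>{1..k}. Aim T k l *\<^sub>R
               (convection_h P (q_E Z l) j - grad_h (mesh P) (phi_I Z l) j)))"
    using qI less.prems by blast
  then have "div_h (mesh P) (q_I Z k) i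
      = div_h (mesh P) qn i - dt P * (\<Sum>l\<in>{1..k}. Aim T k l * ?r l)"
    by (simp only: div_h_diff div_h_scaleR div_h_sum)
  moreover have "dt P \<noteq> 0" using P by (simp add: admissible_params_def)
  ultimately have "(\<Sum>l\<in>{1..k}. Aim T k l * ?r l) = 0"
    using qn div less.prems by simp
  moreover have "{1..k} = insert k {1..<k}" using less.prems by auto
  moreover have "(\<Sum>l\<in>{1..<k}. Aim T k l * ?r l) = 0"
    using less.IH less.prems by (intro sum.neutral) auto
  ultimately have "Aim T k k * ?r k = 0" by simp
  then show ?case using a[OF less.prems] by simp
qed

section \<open>Asymptotic consistency\<close>

theorem theorem6p5:
  fixes P :: params and T :: tableau
    and rhon rho' phi' :: "real \<Rightarrow> real grid" and qn q' :: "real \<Rightarrow> (real ^ 3) grid"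
    and rhon0 rhon2 :: "real grid" and qn0 qn2 :: "(real ^ 3) grid"
    and Z :: "real \<Rightarrow> stages" and Z0 :: stages
  assumes "admissible_params P"
    and "imex_dirk T" and "stiffly_accurate T"
    and "\<forall>k\<in>{1..nstages T}. Aim T k k \<noteq> 0"
    and "well_prepared P rhon qn rhon0 qn0 rhon2 qn2"
    and "\<forall>\<^sub>F \<epsilon> in at_right 0.
           scheme_step P T \<epsilon> (rhon \<epsilon>) (qn \<epsilon>) (Z \<epsilon>) (rho' \<epsilon>) (q' \<epsilon>) (phi' \<epsilon>)"
    and "stages_tendsto T Z Z0"
  shows "(\<forall>k\<in>{1..nstages T}. \<forall>i.
           ((\<lambda>\<epsilon>. rho_I (Z \<epsilon>) k i) \<longlongrightarrow> rho_I Z0 k i) (at_right 0) \<and>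
           rho_I Z0 k i = 1 \<and>
           ((\<lambda>\<epsilon>. div_h (mesh P) (q_I (Z \<epsilon>) k) i) \<longlongrightarrow> div_h (mesh P) (q_I Z0 k) i) (at_right 0) \<and>
           div_h (mesh P) (q_I Z0 k) i = 0) \<and>
         incompressible_limit_scheme P T rhon0 qn0 Z0 \<and>
         (\<forall>i. ((\<lambda>\<epsilon>. rho' \<epsilon> i) \<longlongrightarrow> rho_I Z0 (nstages T) i) (at_right 0) \<and>
             ((\<lambda>\<epsilon>. q' \<epsilon> i) \<longlongrightarrow> q_I Z0 (nstages T) i) (at_right 0) \<and>
             ((\<lambda>\<epsilon>. phi' \<epsilon> i) \<longlongrightarrow> phi_I Z0 (nstages T) i) (at_right 0))"
proof -
  note P = assms(1) and Z = assms(7)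
  let ?s = "nstages T"
  have a: "Aim T k k \<noteq> 0" if "k \<in> {1..?s}" for k using assms(4) that by blast
  have rhon0: "rhon0 = (\<lambda>_. 1)" and div_qn0: "div_h (mesh P) qn0 i = 0" for i
    using assms(5) by (auto simp: well_prepared_def)
  have pos: "\<forall>\<^sub>F \<epsilon> in at_right (0::real). 0 < \<epsilon>" by (rule eventually_at_right_less)
  have rhon: "((\<lambda>\<epsilon>. rhon \<epsilon> i) \<longlongrightarrow> 1) (at_right 0)" for i
  proof (rule Lim_transform_eventually)
    show "((\<lambda>\<epsilon>. rhon0 i + \<epsilon>\<^sup>2 * rhon2 i) \<longlongrightarrow> 1) (at_right 0)"
      by (rule tendsto_eq_intros refl | simp add: rhon0)+
    show "\<forall>\<^sub>F \<epsilon> in at_right 0. rhon0 i + \<epsilon>\<^sup>2 * rhon2 i = rhon \<epsilon> i"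
      using pos by eventually_elim (use assms(5) in \<open>simp add: well_prepared_def\<close>)
  qed
  have qn: "((\<lambda>\<epsilon>. qn \<epsilon> i) \<longlongrightarrow> qn0 i) (at_right 0)" for i
  proof (rule Lim_transform_eventually)
    show "((\<lambda>\<epsilon>. qn0 i + \<epsilon>\<^sup>2 *\<^sub>R qn2 i) \<longlongrightarrow> qn0 i) (at_right 0)"
      by (rule tendsto_eq_intros refl | simp)+
    show "\<forall>\<^sub>F \<epsilon> in at_right 0. qn0 i + \<epsilon>\<^sup>2 *\<^sub>R qn2 i = qn \<epsilon> i"
      using pos by eventually_elim (use assms(5) in \<open>simp add: well_prepared_def\<close>)
  qed
  have step: "\<forall>\<^sub>F \<epsilon> in at_right 0. scheme_stage P T \<epsilon> (rhon \<epsilon>) (qn \<epsilon>) (Z \<epsilon>) k"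
    if "k \<in> {1..?s}" for k
    using assms(6) by eventually_elim (use that in \<open>auto simp: scheme_step_def\<close>)
  have lim:
    "((\<lambda>\<epsilon>. rho_E (Z \<epsilon>) k i) \<longlongrightarrow> rho_E Z0 k i) (at_right 0)"
    "((\<lambda>\<epsilon>. q_E (Z \<epsilon>) k i) \<longlongrightarrow> q_E Z0 k i) (at_right 0)"
    "((\<lambda>\<epsilon>. phi_I (Z \<epsilon>) k i) \<longlongrightarrow> phi_I Z0 k i) (at_right 0)"
    "((\<lambda>\<epsilon>. q_I (Z \<epsilon>) k i) \<longlongrightarrow> q_I Z0 k i) (at_right 0)"
    "((\<lambda>\<epsilon>. rho_I (Z \<epsilon>) k i) \<longlongrightarrow> rho_I Z0 k i) (at_right 0)"
    if "k \<in> {1..?s}" for k i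
    using Z that by (auto simp: stages_tendsto_def)

  \<comment> \<open>The order inside a stage matters: the explicit density from earlier momenta, which licenses the
    limit of the whole stage, which in turn yields the divergence needed by the next stage.\<close>
  have main: "rho_E Z0 k = (\<lambda>_. 1) \<and> (\<forall>i. div_h (mesh P) (q_I Z0 k) i = 0)
               \<and> scheme_stage P T 0 (\<lambda>_. 1) qn0 Z0 k" if "k \<in> {1..?s}" for k
    using that
  proof (induction k rule: less_induct)
    case (less k)
    have le: "l \<in> {1..?s}" if "l \<in> {1..k}" for l using that less.prems by auto
    have prev: "rho_E Z0 l = (\<lambda>_. 1)" "\<And>j. div_h (mesh P) (q_I Z0 l) j = 0" if "l \<in> {1..<k}" for l
      using less.IH[of l] that less.prems by auto
    have "rho_E Z0 k i = 1 - (\<Sum>l\<in>{1..<k}. Aex T k l *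
             (\<Sum>m\<in>UNIV. cfl P m * face_diff m (flux_rho m (q_I Z0 l)) i))" for i
      by (rule scheme_stage_rho_E_limit[OF step[OF less.prems]])
         (use rhon lim less.prems in auto)
    then have rE: "rho_E Z0 k = (\<lambda>_. 1)"
      by (simp add: fun_eq_iff cfl_sum_flux_rho prev(2))
    have rE_le: "rho_E Z0 l = (\<lambda>_. 1)" if "l \<in> {1..k}" for l
      using that rE prev(1)[of l] by (cases "l = k") auto
    have stage: "scheme_stage P T 0 (\<lambda>_. 1) qn0 Z0 k"
    proof (rule scheme_stage_limit[OF step[OF less.prems]])
      show "((\<lambda>\<epsilon>. rho_E (Z \<epsilon>) l i) \<longlongrightarrow> 1) (at_right 0)" if "l \<in> {1..k}" for l i
        using lim(1)[OF le[OF that]] by (simp add: rE_le[OF that])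
    qed (use P rhon qn lim le rE_le less.prems in auto)
    with rE show ?case
      using zero_debye_div_q_I[OF stage P a[OF less.prems] rE prev(2)] by blast
  qed
  have rE: "rho_E Z0 k = (\<lambda>_. 1)" and div: "div_h (mesh P) (q_I Z0 k) i = 0"
    and stage: "scheme_stage P T 0 (\<lambda>_. 1) qn0 Z0 k" if "k \<in> {1..?s}" for k i
    using main[OF that] by auto
  have rI: "rho_I Z0 k i = 1" if "k \<in> {1..?s}" for k i
    by (rule unit_density_rho_I[OF stage[OF that] rE[OF that]]) (use div that in auto)
  have qE: "q_E Z0 k i = qn0 i - dt P *\<^sub>R (\<Sum>l\<in>{1..<k}. Aex T k l *\<^sub>R
           (convection_h P (q_E Z0 l) i - grad_h (mesh P) (phi_I Z0 l) i))"
    if "k \<in> {1..?s}" for k i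
    by (rule unit_density_q_E[OF stage[OF that]]) (use rE that in auto)
  have qI: "q_I Z0 k i = qn0 i - dt P *\<^sub>R (\<Sum>l\<in>{1..k}. Aim T k l *\<^sub>R
           (convection_h P (q_E Z0 l) i - grad_h (mesh P) (phi_I Z0 l) i))"
    if "k \<in> {1..?s}" for k i
    by (rule unit_density_q_I[OF stage[OF that]]) (use rE that in auto)
  note poisson = poisson_of_div_free_stages[of P ?s T qn0 Z0, OF P a div_qn0 qI div]

  have uE: "velocity (rho_E Z0 k) (q_E Z0 k) = q_E Z0 k" if "k \<in> {1..?s}" for k
    by (simp add: fun_eq_iff velocity_def rE[OF that])
  have uI: "velocity (rho_I Z0 k) (q_I Z0 k) = q_I Z0 k" if "k \<in> {1..?s}" for k
    by (simp add: fun_eq_iff velocity_def rI[OF that])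
  have un: "velocity rhon0 qn0 = qn0"
    by (simp add: fun_eq_iff velocity_def rhon0)
  have "incompressible_limit_scheme P T rhon0 qn0 Z0"
    unfolding incompressible_limit_scheme_def Let_def
  proof (intro ballI allI conjI)
    fix k i assume k: "k \<in> {1..?s}"
    have uE_le: "velocity (rho_E Z0 l) (q_E Z0 l) = q_E Z0 l" if "l \<in> {1..k}" for l
      using uE that k by simp
    show "rho_E Z0 k i = 1" by (simp add: rE[OF k])
    show "rho_I Z0 k i = 1" by (rule rI[OF k])
    show "velocity (rho_E Z0 k) (q_E Z0 k) i = velocity rhon0 qn0 i
        - dt P *\<^sub>R (\<Sum>l\<in>{1..<k}. Aex T k l *\<^sub>R
            (convection_h P (velocity (rho_E Z0 l) (q_E Z0 l)) i - grad_h (mesh P) (phi_I Z0 l) i))"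
      unfolding uE[OF k] un by (subst qE[OF k]) (simp add: uE_le)
    show "velocity (rho_I Z0 k) (q_I Z0 k) i = velocity rhon0 qn0 i
        - dt P *\<^sub>R (\<Sum>l\<in>{1..k}. Aim T k l *\<^sub>R
            (convection_h P (velocity (rho_E Z0 l) (q_E Z0 l)) i - grad_h (mesh P) (phi_I Z0 l) i))"
      unfolding uI[OF k] un by (subst qI[OF k]) (simp add: uE_le)
    show "div_h (mesh P) (grad_h (mesh P) (phi_I Z0 k)) i
        = div_h (mesh P) (convection_h P (velocity (rho_E Z0 k) (q_E Z0 k))) i"
      unfolding uE[OF k] by (rule poisson) (use k in auto)
  qed
  moreover have "((\<lambda>\<epsilon>. div_h (mesh P) (q_I (Z \<epsilon>) k) i) \<longlongrightarrow> div_h (mesh P) (q_I Z0 k) i) (at_right 0)"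
    if "k \<in> {1..?s}" for k i
    by (intro tendsto_div_h lim that)
  moreover have "((\<lambda>\<epsilon>. rho' \<epsilon> i) \<longlongrightarrow> rho_I Z0 ?s i) (at_right 0) \<and>
             ((\<lambda>\<epsilon>. q' \<epsilon> i) \<longlongrightarrow> q_I Z0 ?s i) (at_right 0) \<and>
             ((\<lambda>\<epsilon>. phi' \<epsilon> i) \<longlongrightarrow> phi_I Z0 ?s i) (at_right 0)" for i
  proof -
    have last: "?s \<in> {1..?s}" using assms(2) by (simp add: imex_dirk_def)
    have update: "\<forall>\<^sub>F \<epsilon> in at_right 0.
        rho_I (Z \<epsilon>) ?s i = rho' \<epsilon> i \<and> q_I (Z \<epsilon>) ?s i = q' \<epsilon> i \<and> phi_I (Z \<epsilon>) ?s i = phi' \<epsilon> i"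
      using assms(6) by eventually_elim (simp add: scheme_step_def)
    show ?thesis
      by (intro conjI; rule Lim_transform_eventually[OF lim(5)[OF last]]
            Lim_transform_eventually[OF lim(4)[OF last]] Lim_transform_eventually[OF lim(3)[OF last]];
          use update in eventually_elim; simp)
  qed
  ultimately show ?thesis
    using lim(5) rI div by blast
qed

end
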